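(* Let $X$ be a real Hilbert space, let $C$ be a closed convex (possibly empty) subset of $X$, and let $x_0\in X$. Let $(x_n)_{n\in\mathbb N}$, $(y_n)_{n\in\mathbb N}$ be sequences in $X$ and $(C_n)_{n\in\mathbb N}$ a sequence of nonempty subsets of $X$ such that $C_0=X$ and, for every $n\in\mathbb N$, $$C_{n+1}=C_n\cap H(x_n,y_n)\quad\text{and}\quad x_{n+1}=P_{C_{n+1}}x_0,$$ where the points $y_n\in X$ are otherwise arbitrary. Suppose that $C\subseteq C_n$ for every $n\in\mathbb N$, and that for every subsequence $(x_{k_n})_{n\in\mathbb N}$ of $(x_n)_{n\in\mathbb N}$ and every $\bar x\in X$, $$\big(x_{k_n}\to\bar x \ \text{ and }\ x_{k_n}-y_{k_n}\to 0\big)\ \Longrightarrow\ \bar x\in C,$$ where convergence is in norm. Then exactly one of the following holds: (i) $C\neq\varnothing$ and $x_n\to P_Cx_0$ (in norm); (ii) $C=\varnothing$ and $\|x_n\|\to+\infty$.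
   Context: $\mathbb N=\{0,1,2,\dots\}$. For $x,y\in X$, $H(x,y):=\{z\in X : \|y-z\|\le\|x-z\|\}=\{z\in X: 2\langle z,x-y\rangle\le\|x\|^2-\|y\|^2\}$, which is $X$ if $x=y$ and a closed halfspace otherwise; hence each $C_n$ is closed and convex. For a nonempty closed convex set $D\subseteq X$, $P_D x$ denotes the unique point of $D$ nearest to $x$ (the metric projection). *)

theory Defs
  imports "HOL-Analysis.Analysis"
begin

(* A real Hilbert space is a type of sort {real_inner, complete_space}. *)

definition H :: "'a::real_inner \<Rightarrow> 'a \<Rightarrow> 'a set" where
  "H x y = {z. norm (y - z) \<le> norm (x - z)}"

lemma H_eq_halfspace: "H x y = {z. 2 * (z \<bullet> (x - y)) \<le> (norm x)\<^sup>2 - (norm y)\<^sup>2}"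
  unfolding H_def norm_le
  by (auto simp: power2_norm_eq_inner inner_diff_left inner_diff_right inner_commute)

(* The library's closest_point needs heine_borel, which forces finite dimension.
   The nearest point is unique when D is nonempty, closed and convex in a Hilbert
   space; for other D the value may be unspecified. *)
definition metric_proj :: "'a::real_inner set \<Rightarrow> 'a \<Rightarrow> 'a" where
  "metric_proj D x = (THE p. p \<in> D \<and> (\<forall>z\<in>D. norm (x - p) \<le> norm (x - z)))"

end

theory Submission
  imports Defs
begin

text \<open>
  Everything rests on one consequence of the parallelogram law: if two points of a convex set
  are both almost as close to \<open>x\<close> as the whole set is, then they are close to each other
  (\<open>convex_almost_nearest_close\<close>). Applied to a minimizing sequence it gives the nearest point of
  a closed convex set; applied to two nearest points it gives uniqueness.

  In the theorem each \<open>x n\<close> is the point of \<open>Cn n\<close> nearest to \<open>x0\<close>. As the sets shrink, the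
  distances \<open>norm (x0 - x n)\<close> increase, and any point of \<open>C\<close> bounds them from above. If they are
  bounded, they converge, and since for \<open>n \<le> m\<close> both \<open>x n\<close> and \<open>x m\<close> lie in \<open>Cn n\<close>, the same estimate
  makes \<open>x\<close> a Cauchy sequence. Its limit \<open>p\<close> is at least as close to \<open>x0\<close> as any point of \<open>C\<close>.
  Moreover \<open>x (Suc n) \<in> H (x n) (y n)\<close> says that \<open>y n\<close> is at least as close to \<open>x (Suc n)\<close> as
  \<open>x n\<close> is, so \<open>x n - y n\<close> tends to \<open>0\<close>; the hypothesis on subsequences, taken for \<open>x\<close> itself,
  then puts \<open>p\<close> in \<open>C\<close>. Hence bounded distances force \<open>C \<noteq> {}\<close> and convergence to the projection,
  while unbounded ones force \<open>C = {}\<close> and, being monotone, divergence to infinity.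
\<close>

section \<open>Nearest points of closed convex sets\<close>

text \<open>
  The midpoint of \<open>p\<close> and \<open>q\<close> lies in \<open>D\<close>, hence has distance at least \<open>d\<close> from \<open>x\<close>; the
  parallelogram law for \<open>x - p\<close> and \<open>x - q\<close> turns this into a bound on \<open>norm (p - q)\<close>.
\<close>
lemma convex_almost_nearest_close:
  fixes D :: "'a::real_inner set"
  assumes "convex D" "p \<in> D" "q \<in> D"
    and "0 \<le> d" "\<And>z. z \<in> D \<Longrightarrow> d \<le> norm (x - z)"
  shows "(norm (p - q))\<^sup>2 \<le> 2 * ((norm (x - p))\<^sup>2 - d\<^sup>2) + 2 * ((norm (x - q))\<^sup>2 - d\<^sup>2)"
proof -
  define c where "c = (1/2) *\<^sub>R p + (1/2) *\<^sub>R q"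
  have "c \<in> D"
    unfolding c_def using assms(1-3) by (intro convexD) auto
  then have "d\<^sup>2 \<le> (norm (x - c))\<^sup>2"
    using assms(4,5) by (intro power_mono)
  moreover have "(norm (p - q))\<^sup>2 + 4 * (norm (x - c))\<^sup>2 = 2 * (norm (x - p))\<^sup>2 + 2 * (norm (x - q))\<^sup>2"
    unfolding c_def power2_norm_eq_inner
    by (simp add: algebra_simps inner_commute)
  ultimately show ?thesis by (simp add: right_diff_distrib)
qed

lemma Cauchy_if_norm_power2_le:
  fixes z :: "nat \<Rightarrow> 'a::real_normed_vector" and b :: "nat \<Rightarrow> real"
  assumes b: "b \<longlonglongrightarrow> 0"
    and le: "\<And>m n. n \<le> m \<Longrightarrow> (norm (z n - z m))\<^sup>2 \<le> b n + b m"
  shows "Cauchy z"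
  unfolding Cauchy_altdef
proof (intro allI impI)
  fix e :: real assume "0 < e"
  then have "0 < e\<^sup>2 / 2" by simp
  with b have "\<forall>\<^sub>F n in sequentially. b n < e\<^sup>2 / 2"
    by (rule order_tendstoD)
  then obtain N where N: "\<And>n. n \<ge> N \<Longrightarrow> b n < e\<^sup>2 / 2"
    by (auto simp: eventually_sequentially)
  have "dist (z n) (z m) < e" if "n \<ge> N" "m > n" for m n
  proof -
    have "(norm (z n - z m))\<^sup>2 < e\<^sup>2"
      using le[of n m] N[of n] N[of m] that by simp
    then show ?thesis
      using \<open>0 < e\<close> by (simp add: dist_norm power_less_imp_less_base)
  qed
  then show "\<exists>M. \<forall>m\<ge>M. \<forall>n>m. dist (z m) (z n) < e" by blast
qed

text \<open>
  A minimizing sequence is Cauchy by the two preceding lemmas, and its limit realizes the infimum.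
\<close>
lemma nearest_point_exists:
  fixes D :: "'a::{real_inner, complete_space} set"
  assumes "closed D" "convex D" "D \<noteq> {}"
  obtains p where "p \<in> D" "\<And>z. z \<in> D \<Longrightarrow> norm (x - p) \<le> norm (x - z)"
proof -
  define d where "d = (INF z\<in>D. norm (x - z))"
  have bdd: "bdd_below ((\<lambda>z. norm (x - z)) ` D)"
    by (rule bdd_belowI2[of _ 0]) simp
  have d_le: "d \<le> norm (x - z)" if "z \<in> D" for z
    unfolding d_def using bdd that by (rule cINF_lower)
  have "0 \<le> d"
    unfolding d_def using assms(3) by (intro cINF_greatest) auto
  have "\<exists>z\<in>D. norm (x - z) < d + inverse (real (Suc n))" for n
  proof -
    have "d < d + inverse (real (Suc n))" by simp
    then show ?thesis
      unfolding d_def using cINF_less_iff[OF assms(3) bdd] by blast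
  qed
  then obtain z where z: "\<And>n. z n \<in> D" "\<And>n. norm (x - z n) < d + inverse (real (Suc n))"
    by metis
  have "(\<lambda>n. d + inverse (real (Suc n))) \<longlonglongrightarrow> d + 0"
    by (intro tendsto_intros LIMSEQ_inverse_real_of_nat)
  then have lim_d: "(\<lambda>n. norm (x - z n)) \<longlonglongrightarrow> d"
    using tendsto_sandwich[OF _ _ tendsto_const, of d "\<lambda>n. norm (x - z n)" sequentially
        "\<lambda>n. d + inverse (real (Suc n))"] d_le[OF z(1)] less_imp_le[OF z(2)]
    by (simp del: of_nat_Suc)
  have "(\<lambda>n. 2 * ((norm (x - z n))\<^sup>2 - d\<^sup>2)) \<longlonglongrightarrow> 2 * (d\<^sup>2 - d\<^sup>2)"
    by (intro tendsto_intros lim_d)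
  then have "(\<lambda>n. 2 * ((norm (x - z n))\<^sup>2 - d\<^sup>2)) \<longlonglongrightarrow> 0" by simp
  then have "Cauchy z"
    by (rule Cauchy_if_norm_power2_le)
       (rule convex_almost_nearest_close[OF assms(2) z(1) z(1) \<open>0 \<le> d\<close> d_le])
  then obtain p where p: "z \<longlonglongrightarrow> p"
    using Cauchy_convergent convergent_def by blast
  have "p \<in> D"
    using closed_sequentially[OF assms(1) _ p] z(1) by blast
  moreover have "norm (x - p) = d"
    using tendsto_norm[OF tendsto_diff[OF tendsto_const p]] lim_d by (rule LIMSEQ_unique)
  ultimately show thesis
    using that d_le by blast
qed

lemma metric_proj_eqI:
  fixes D :: "'a::real_inner set"
  assumes "convex D" "p \<in> D" "\<And>z. z \<in> D \<Longrightarrow> norm (x - p) \<le> norm (x - z)"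
  shows "metric_proj D x = p"
  unfolding metric_proj_def
proof (rule the_equality)
  show "p \<in> D \<and> (\<forall>z\<in>D. norm (x - p) \<le> norm (x - z))" using assms by blast
next
  fix q assume q: "q \<in> D \<and> (\<forall>z\<in>D. norm (x - q) \<le> norm (x - z))"
  then have "q \<in> D" "norm (x - q) = norm (x - p)"
    using assms(2,3) by (auto intro: order_antisym)
  then have "(norm (p - q))\<^sup>2 \<le> 0"
    using convex_almost_nearest_close[OF assms(1,2) \<open>q \<in> D\<close> norm_ge_zero assms(3)] by simp
  then show "q = p" by simp
qed

lemma metric_proj_nearest:
  fixes D :: "'a::{real_inner, complete_space} set"
  assumes "closed D" "convex D" "D \<noteq> {}"
  shows "metric_proj D x \<in> D"
    and "z \<in> D \<Longrightarrow> norm (x - metric_proj D x) \<le> norm (x - z)"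
proof -
  obtain p where p: "p \<in> D" "\<And>z. z \<in> D \<Longrightarrow> norm (x - p) \<le> norm (x - z)"
    using nearest_point_exists[OF assms] by blast
  then have "metric_proj D x = p"
    using metric_proj_eqI[OF assms(2)] by blast
  then show "metric_proj D x \<in> D" "z \<in> D \<Longrightarrow> norm (x - metric_proj D x) \<le> norm (x - z)"
    using p by auto
qed

lemma H_eq_inner_halfspace: "H x y = {z. (x - y) \<bullet> z \<le> ((norm x)\<^sup>2 - (norm y)\<^sup>2) / 2}"
  unfolding H_eq_halfspace by (auto simp: inner_commute)

lemma closed_H: "closed (H x y)"
  unfolding H_eq_inner_halfspace by (rule closed_halfspace_le)

lemma convex_H: "convex (H x y)"
  unfolding H_eq_inner_halfspace by (rule convex_halfspace_le)

section \<open>Projections onto a shrinking sequence of convex sets\<close>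

text \<open>
  For \<open>n \<le> m\<close> both points lie in \<open>D n\<close>, where \<open>x n\<close> is nearest; so the squared distance between them is
  at most twice the increase of the convergent sequence \<open>(norm (a - x n))\<^sup>2\<close>.
\<close>
lemma nearest_points_of_decreasing_convex_Cauchy:
  fixes x :: "nat \<Rightarrow> 'a::real_inner"
  assumes "decseq D" "\<And>n. convex (D n)" "\<And>n. x n \<in> D n"
    and near: "\<And>n z. z \<in> D n \<Longrightarrow> norm (a - x n) \<le> norm (a - z)"
    and bound: "\<And>n. norm (a - x n) \<le> B"
  shows "Cauchy x"
proof -
  have mem: "x m \<in> D n" if "n \<le> m" for m n
    using decseqD[OF assms(1) that] assms(3) by blast
  have "incseq (\<lambda>n. norm (a - x n))"
    using near mem by (intro monoI) blast
  then obtain L where L: "(\<lambda>n. norm (a - x n)) \<longlonglongrightarrow> L" and le_L: "\<And>n. norm (a - x n) \<le> L"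
    using incseq_convergent[of _ B] bound by metis
  show ?thesis
  proof (rule Cauchy_if_norm_power2_le)
    have "(\<lambda>n. 2 * (L\<^sup>2 - (norm (a - x n))\<^sup>2)) \<longlonglongrightarrow> 2 * (L\<^sup>2 - L\<^sup>2)"
      by (intro tendsto_intros L)
    then show "(\<lambda>n. 2 * (L\<^sup>2 - (norm (a - x n))\<^sup>2)) \<longlonglongrightarrow> 0" by simp
  next
    fix m n :: nat assume "n \<le> m"
    have "(norm (x n - x m))\<^sup>2 \<le> 2 * ((norm (a - x m))\<^sup>2 - (norm (a - x n))\<^sup>2)"
      using convex_almost_nearest_close[OF assms(2,3) mem[OF \<open>n \<le> m\<close>] norm_ge_zero near[of _ n]]
      by simp
    moreover have "(norm (a - x m))\<^sup>2 \<le> L\<^sup>2"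
      using le_L by (intro power_mono) auto
    ultimately show "(norm (x n - x m))\<^sup>2
        \<le> 2 * (L\<^sup>2 - (norm (a - x n))\<^sup>2) + 2 * (L\<^sup>2 - (norm (a - x m))\<^sup>2)"
      by (simp add: right_diff_distrib)
  qed
qed

text \<open>
  By the definition of \<open>H\<close> and the triangle inequality, \<open>norm (x n - y n) \<le> 2 * norm (x n - x (Suc n))\<close>.
\<close>
lemma diff_tendsto_zero_if_Suc_in_H:
  assumes "x \<longlonglongrightarrow> p" and H: "\<And>n. x (Suc n) \<in> H (x n) (y n)"
  shows "(\<lambda>n. x n - y n) \<longlonglongrightarrow> 0"
proof (rule Lim_null_comparison)
  have "(\<lambda>n. 2 * norm (x n - x (Suc n))) \<longlonglongrightarrow> 2 * norm (p - p)"
    by (intro tendsto_intros assms(1) LIMSEQ_Suc)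
  then show "(\<lambda>n. 2 * norm (x n - x (Suc n))) \<longlonglongrightarrow> 0" by simp
next
  have "norm (x n - y n) \<le> 2 * norm (x n - x (Suc n))" for n
  proof -
    have "norm (y n - x (Suc n)) \<le> norm (x n - x (Suc n))"
      using H[of n] by (simp add: H_def)
    then show ?thesis
      using norm_triangle_ineq4[of "x n - x (Suc n)" "y n - x (Suc n)"] by simp
  qed
  then show "\<forall>\<^sub>F n in sequentially. norm (x n - y n) \<le> 2 * norm (x n - x (Suc n))"
    by simp
qed

lemma filterlim_at_top_if_incseq_unbounded:
  fixes r :: "nat \<Rightarrow> real"
  assumes "incseq r" "\<And>B. \<exists>n. B < r n"
  shows "filterlim r at_top sequentially"
  unfolding filterlim_at_top eventually_sequentially
proof (intro allI)
  fix B :: real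
  obtain N where "B < r N" using assms(2) by blast
  then have "B \<le> r n" if "N \<le> n" for n
    using incseqD[OF assms(1) that] by simp
  then show "\<exists>N. \<forall>n\<ge>N. B \<le> r n" by blast
qed

theorem theorem1p3:
  fixes C :: "'a::{real_inner, complete_space} set"
    and x0 :: 'a
    and x y :: "nat \<Rightarrow> 'a"
    and Cn :: "nat \<Rightarrow> 'a set"
  assumes "closed C" and "convex C"
    and "x 0 = x0"
    and "\<And>n. Cn n \<noteq> {}"
    and "Cn 0 = UNIV"
    and "\<And>n. Cn (Suc n) = Cn n \<inter> H (x n) (y n)"
    and "\<And>n. x (Suc n) = metric_proj (Cn (Suc n)) x0"
    and "\<And>n. C \<subseteq> Cn n"
    and "\<And>(k :: nat \<Rightarrow> nat) xbar. strict_mono k \<Longrightarrow>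
           (\<lambda>n. x (k n)) \<longlonglongrightarrow> xbar \<Longrightarrow> (\<lambda>n. x (k n) - y (k n)) \<longlonglongrightarrow> 0 \<Longrightarrow> xbar \<in> C"
  shows "((C \<noteq> {} \<and> x \<longlonglongrightarrow> metric_proj C x0) \<or>
          (C = {} \<and> filterlim (\<lambda>n. norm (x n)) at_top sequentially)) \<and>
         \<not> ((C \<noteq> {} \<and> x \<longlonglongrightarrow> metric_proj C x0) \<and>
            (C = {} \<and> filterlim (\<lambda>n. norm (x n)) at_top sequentially))"
proof -
  note convex_C = assms(2) and nonempty = assms(4)
    and Cn_0 = assms(5) and Cn_Suc = assms(6) and C_sub = assms(8) and limit_in_C = assms(9)
  have closed_Cn: "closed (Cn n)" and convex_Cn: "convex (Cn n)" for n
    by (induction n) (auto simp: Cn_0 Cn_Suc closed_H convex_H intro: closed_Int convex_Int)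
  have proj: "x n = metric_proj (Cn n) x0" for n
  proof (cases n)
    case 0
    then show ?thesis
      using assms(3) Cn_0 metric_proj_eqI[of UNIV x0 x0] by simp
  next
    case (Suc k)
    then show ?thesis using assms(7) by simp
  qed
  have x_mem: "x n \<in> Cn n" for n
    unfolding proj by (rule metric_proj_nearest(1)[OF closed_Cn convex_Cn nonempty])
  have near: "norm (x0 - x n) \<le> norm (x0 - z)" if "z \<in> Cn n" for n z
    unfolding proj using that by (rule metric_proj_nearest(2)[OF closed_Cn convex_Cn nonempty])
  have dec: "decseq Cn"
    by (rule decseq_SucI) (simp add: Cn_Suc)
  have inc: "incseq (\<lambda>n. norm (x0 - x n))"
    by (rule incseq_SucI) (use near x_mem Cn_Suc in blast)
  have le_C: "norm (x0 - x n) \<le> norm (x0 - c)" if "c \<in> C" for n c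
    using near C_sub that by blast
  have "(C \<noteq> {} \<and> x \<longlonglongrightarrow> metric_proj C x0) \<or>
        (C = {} \<and> filterlim (\<lambda>n. norm (x n)) at_top sequentially)"
  proof (cases "\<exists>B. \<forall>n. norm (x0 - x n) \<le> B")
    case True
    then obtain B where "\<And>n. norm (x0 - x n) \<le> B" by blast
    then have "Cauchy x"
      by (intro nearest_points_of_decreasing_convex_Cauchy[OF dec convex_Cn x_mem, of x0 B] near)
    then obtain p where p: "x \<longlonglongrightarrow> p"
      using Cauchy_convergent convergent_def by blast
    have "x (Suc n) \<in> H (x n) (y n)" for n
      using x_mem[of "Suc n"] Cn_Suc by simp
    then have "(\<lambda>n. x n - y n) \<longlonglongrightarrow> 0"
      by (rule diff_tendsto_zero_if_Suc_in_H[OF p])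
    then have "p \<in> C"
      using limit_in_C[of "\<lambda>n. n" p] p by (simp add: strict_mono_def)
    moreover have "norm (x0 - p) \<le> norm (x0 - c)" if "c \<in> C" for c
      using tendsto_norm[OF tendsto_diff[OF tendsto_const p]] le_C[OF that]
      by (intro LIMSEQ_le_const2[of "\<lambda>n. norm (x0 - x n)"]) auto
    ultimately have "metric_proj C x0 = p"
      by (rule metric_proj_eqI[OF convex_C])
    with p \<open>p \<in> C\<close> show ?thesis by blast
  next
    case False
    then have "filterlim (\<lambda>n. norm (x0 - x n)) at_top sequentially"
      by (intro filterlim_at_top_if_incseq_unbounded[OF inc]) (simp add: not_le)
    then have "filterlim (\<lambda>n. - norm x0 + norm (x0 - x n)) at_top sequentially"
      by (rule filterlim_tendsto_add_at_top[OF tendsto_const])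
    moreover have "- norm x0 + norm (x0 - x n) \<le> norm (x n)" for n
      using norm_triangle_ineq4[of x0 "x n"] by linarith
    ultimately have "filterlim (\<lambda>n. norm (x n)) at_top sequentially"
      by (blast intro: filterlim_at_top_mono always_eventually)
    moreover have "C = {}"
      using False le_C by blast
    ultimately show ?thesis by blast
  qed
  then show ?thesis by blast
qed

end
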